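(* Let $f:\mathbb{R}^n\to\mathbb{R}$ be twice continuously differentiable and bounded below by $f_{\mathrm{low}}$, and consider Algorithm ARC_SO described in the context, with tolerances $\epsilon,\epsilon_H>0$, $\alpha\in\left[0,\frac23\right)$ and $\eta_2\in\left(0,\frac{2-3\alpha}{2}\right)$. Suppose that, for constants $L>0$ and $\kappa_B\ge0$ and for all $k\ge 0$, $\|\nabla^2 f(x_k+\beta s_k)-\nabla^2 f(x_k)\|\le L\beta\|s_k\|$ for all $\beta\in[0,1]$, and $\|B_k\|\le\kappa_B$. Suppose that one of the following holds: (a) the steps satisfy $\|\nabla_s m(x_k,s_k,\sigma_k)\|\le\theta\min\left(\|s_k\|^2,\|\nabla f(x_k)\|\right)$; or (b) the steps satisfy $\|\nabla_s m(x_k,s_k,\sigma_k)\|\le\theta\min(1,\|s_k\|)\,\|\nabla f(x_k)\|$, and there is a constant $\kappa_H$ with $\|\nabla^2 f(x_k+\beta s_k)\|\le\kappa_H$ for all $k\ge0$ and $\beta\in[0,1]$. Suppose also that $m(x_k,s_k,\sigma_k)\le m(x_k,s_k^E,\sigma_k)$ whenever $B_k$ is not positive semidefinite. Then Algorithm ARC_SO produces an iterate $x_{\widehat k}$ satisfying $$\|\nabla f(x_{\widehat k})\|\le\epsilon\quad\text{and}\quad\lambda_{\min}(B_{\widehat k})\ge-\epsilon_H$$ within at most $O\left(\max(\epsilon^{-3/2},\epsilon_H^{-3})\right)$ iterations, where the constant in $O(\cdot)$ does not depend on $\epsilon$ and $\epsilon_H$ (and $O(\cdot)$ refers to small tolerances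 $\epsilon,\epsilon_H$).
   Context: $\|\cdot\|$ is the Euclidean vector norm and the induced matrix norm; $\lambda_{\min}$ denotes the smallest eigenvalue. For a symmetric matrix $B_k\in\mathbb{R}^{n\times n}$ and $\sigma_k>0$ let $$T_2(x_k,s)=f(x_k)+\nabla f(x_k)^Ts+\tfrac12 s^TB_ks,\quad m(x_k,s,\sigma_k)=T_2(x_k,s)+\tfrac{\sigma_k}{3}\|s\|^3,\quad \rho_k=\frac{f(x_k)-f(x_k+s_k)}{T_2(x_k,0)-T_2(x_k,s_k)} .$$ ALGORITHM ARC_SO. Step 0. Given $x_0\in\mathbb{R}^n$, $\sigma_0>0$, tolerances $\epsilon,\epsilon_H>0$, and parameters $0<\theta<1$, $\alpha\in[0,\frac23)$, $\sigma_{\min}\in(0,\sigma_0]$, $0<\eta_1\le\eta_2<\frac{2-3\alpha}{2}$, $0<\gamma_1<1<\gamma_2<\gamma_3$, $C>0$, $\kappa_{\mathrm{snc}}\in(0,1]$. Set $k=0$, $C_0=C$, flag $=1$. Termination: the algorithm stops at iteration $k$ when $\|\nabla f(x_k)\|\le\epsilon$ and $\lambda_{\min}(B_k)\ge-\epsilon_H$. Step 2. Compute a symmetric $B_k$ with $\|\nabla^2 f(x_k)-B_k\|\le C_k$. Step 3. Choose $\theta_k\le\theta$ and compute $s_k$ with $m(x_k,s_k,\sigma_k)<m(x_k,0,\sigma_k)$, $\|\nabla_s m(x_k,s_k,\sigma_k)\|\le\theta_k\|\nabla f(x_k)\|$ and, if $B_k$ is not positive semidefinite, $m(x_k,s_k,\sigma_k)\le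 m(x_k,s_k^E,\sigma_k)$. Here $$s_k^E=\alpha_k^Eu_k,\qquad \alpha_k^E=\operatorname*{argmin}_{a\ge0}\,m(x_k,au_k,\sigma_k)\ \text{(global minimizer)},$$ where $u_k$ is an approximation of an eigenvector of $B_k$ for $\lambda_{\min}(B_k)$ in the sense that $\nabla f(x_k)^Tu_k\le0$ and $u_k^TB_ku_k\le\kappa_{\mathrm{snc}}\lambda_{\min}(B_k)\|u_k\|^2$ (with $u_k\ne0$). Step 4. If $\|s_k\|<1$ and flag $=1$ and $C>\alpha(1-\theta)\|\nabla f(x_k)\|$: set $x_{k+1}=x_k$, $\sigma_{k+1}=\sigma_k$ (unsuccessful iteration in the sense of Step 4), $C_{k+1}=\alpha(1-\theta)\|\nabla f(x_k)\|$, flag $=0$, increment $k$ and go to Step 2. Step 5. Compute $\rho_k$. If $\rho_k\ge\eta_1$ (successful iteration): set $x_{k+1}=x_k+s_k$; choose $\sigma_{k+1}\in[\max(\sigma_{\min},\gamma_1\sigma_k),\sigma_k]$ if $\rho_k\ge\eta_2$, $\sigma_{k+1}\in[\sigma_k,\gamma_2\sigma_k]$ if $\rho_k\in[\eta_1,\eta_2)$; if $\|s_k\|\ge1$ set $C_{k+1}=C$, flag $=1$, otherwise set $C_{k+1}=\alpha(1-\theta)\|\nabla f(x_{k+1})\|$, flag $=0$; increment $k$ and go to Step 2. If $\rho_k<\eta_1$ (unsuccessful iteration in the sense of Step 5): set $x_{k+1}=x_k$, choose $\sigma_{k+1}\in[\gamma_2\sigma_k,\gamma_3\sigma_k]$,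 set $C_{k+1}=C_k$, $B_{k+1}=B_k$, increment $k$ and go to Step 3. Standing accuracy property: at every iteration that is successful or unsuccessful in the sense of Step 5, one has $\|\nabla^2 f(x_k)-B_k\|\le C$ if $\|s_k\|\ge1$, and $\|\nabla^2 f(x_k)-B_k\|\le\alpha(1-\theta)\|\nabla f(x_k)\|$ if $\|s_k\|<1$. *)

theory Defs
  imports "HOL-Analysis.Analysis"
begin

definition grad :: "(real^'n \<Rightarrow> real) \<Rightarrow> real^'n \<Rightarrow> real^'n" where
  "grad F x = (THE D. GDERIV F x :> D)"

definition hess :: "(real^'n \<Rightarrow> real) \<Rightarrow> real^'n \<Rightarrow> real^'n^'n" where
  "hess F x = jacobian (grad F) (at x)"

definition twice_cont_diff :: "(real^'n \<Rightarrow> real) \<Rightarrow> bool" where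
  "twice_cont_diff F \<longleftrightarrow>
     (\<forall>x. F differentiable (at x)) \<and> (\<forall>x. grad F differentiable (at x)) \<and>
     continuous_on UNIV (hess F)"

text \<open>
  The type class norm on \<open>real^'n^'n\<close> is the Frobenius norm; the norm
  induced by the Euclidean vector norm is the operator norm of the associated linear map.
\<close>

definition mat_norm :: "real^'n^'n \<Rightarrow> real" where
  "mat_norm A = onorm ((*v) A)"

definition positive_semidefinite :: "real^'n^'n \<Rightarrow> bool" where
  "positive_semidefinite A \<longleftrightarrow> (\<forall>v. 0 \<le> v \<bullet> (A *v v))"

text \<open>Only meaningful for symmetric matrices: the set of real eigenvalues is then finite and nonempty.\<close>

definition lambda_min :: "real^'n^'n \<Rightarrow> real" where
  "lambda_min A = Min {l. \<exists>v. v \<noteq> 0 \<and> A *v v = l *\<^sub>R v}"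

definition taylor2 :: "(real^'n \<Rightarrow> real) \<Rightarrow> real^'n^'n \<Rightarrow> real^'n \<Rightarrow> real^'n \<Rightarrow> real" where
  "taylor2 f B x s = f x + grad f x \<bullet> s + 1/2 * (s \<bullet> (B *v s))"

definition cubic_model ::
  "(real^'n \<Rightarrow> real) \<Rightarrow> real^'n^'n \<Rightarrow> real^'n \<Rightarrow> real^'n \<Rightarrow> real \<Rightarrow> real" where
  "cubic_model f B x s \<sigma> = taylor2 f B x s + \<sigma> / 3 * norm s ^ 3"

definition cubic_model_grad ::
  "(real^'n \<Rightarrow> real) \<Rightarrow> real^'n^'n \<Rightarrow> real^'n \<Rightarrow> real^'n \<Rightarrow> real \<Rightarrow> real^'n" where
  "cubic_model_grad f B x s \<sigma> = grad (\<lambda>t. cubic_model f B x t \<sigma>) s"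

record arc_params =
  p_sigma0 :: real
  p_theta :: real
  p_alpha :: real
  p_sigma_min :: real
  p_eta1 :: real
  p_eta2 :: real
  p_gamma1 :: real
  p_gamma2 :: real
  p_gamma3 :: real
  p_C :: real
  p_kappa_snc :: real

definition arc_params_ok :: "arc_params \<Rightarrow> bool" where
  "arc_params_ok P \<longleftrightarrow>
     0 < p_sigma0 P \<and> 0 < p_theta P \<and> p_theta P < 1 \<and>
     0 \<le> p_alpha P \<and> p_alpha P < 2/3 \<and>
     0 < p_sigma_min P \<and> p_sigma_min P \<le> p_sigma0 P \<and>
     0 < p_eta1 P \<and> p_eta1 P \<le> p_eta2 P \<and> p_eta2 P < (2 - 3 * p_alpha P) / 2 \<and>
     0 < p_gamma1 P \<and> p_gamma1 P < 1 \<and> 1 < p_gamma2 P \<and> p_gamma2 P < p_gamma3 P \<and>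
     0 < p_C P \<and> 0 < p_kappa_snc P \<and> p_kappa_snc P \<le> 1"

text \<open>
  The data generated by one execution of ARC-SO. The fields are total sequences, but they are
  only constrained up to the stopping iteration; the entries beyond it carry no meaning.
  The fields \<open>uvec\<close> and \<open>aE\<close> hold the approximate eigenvector and the
  one-dimensional minimizer, so that the eigenstep is their product.
\<close>

record ('n::finite) arc_run =
  xit :: "nat \<Rightarrow> real^'n"
  step :: "nat \<Rightarrow> real^'n"
  sig :: "nat \<Rightarrow> real"
  Bmat :: "nat \<Rightarrow> real^'n^'n"
  Cacc :: "nat \<Rightarrow> real"
  flg :: "nat \<Rightarrow> bool"
  thet :: "nat \<Rightarrow> real"
  uvec :: "nat \<Rightarrow> real^'n"
  aE :: "nat \<Rightarrow> real"

definition arc_stops ::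
  "(real^'n \<Rightarrow> real) \<Rightarrow> real \<Rightarrow> real \<Rightarrow> ('n::finite) arc_run \<Rightarrow> nat \<Rightarrow> bool" where
  "arc_stops f \<epsilon> \<epsilon>H R k \<longleftrightarrow>
     norm (grad f (xit R k)) \<le> \<epsilon> \<and> lambda_min (Bmat R k) \<ge> - \<epsilon>H"

text \<open>
  Iteration \<open>k\<close> is reached when the algorithm has not stopped before \<open>k\<close>, so
  that \<open>x\<^sub>k\<close> and \<open>B\<^sub>k\<close> are computed; it is executed when the
  algorithm moreover does not stop at \<open>k\<close>, so that the step is computed as well.
\<close>

definition arc_reached ::
  "(real^'n \<Rightarrow> real) \<Rightarrow> real \<Rightarrow> real \<Rightarrow> ('n::finite) arc_run \<Rightarrow> nat \<Rightarrow> bool" where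
  "arc_reached f \<epsilon> \<epsilon>H R k \<longleftrightarrow> (\<forall>j<k. \<not> arc_stops f \<epsilon> \<epsilon>H R j)"

definition arc_executed ::
  "(real^'n \<Rightarrow> real) \<Rightarrow> real \<Rightarrow> real \<Rightarrow> ('n::finite) arc_run \<Rightarrow> nat \<Rightarrow> bool" where
  "arc_executed f \<epsilon> \<epsilon>H R k \<longleftrightarrow> (\<forall>j\<le>k. \<not> arc_stops f \<epsilon> \<epsilon>H R j)"

definition arc_rho :: "(real^'n \<Rightarrow> real) \<Rightarrow> ('n::finite) arc_run \<Rightarrow> nat \<Rightarrow> real" where
  "arc_rho f R k =
     (f (xit R k) - f (xit R k + step R k)) /
     (taylor2 f (Bmat R k) (xit R k) 0 - taylor2 f (Bmat R k) (xit R k) (step R k))"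

definition eigenstep :: "('n::finite) arc_run \<Rightarrow> nat \<Rightarrow> real^'n" where
  "eigenstep R k = aE R k *\<^sub>R uvec R k"

definition arc_eigenstep_ok ::
  "(real^'n \<Rightarrow> real) \<Rightarrow> arc_params \<Rightarrow> ('n::finite) arc_run \<Rightarrow> nat \<Rightarrow> bool" where
  "arc_eigenstep_ok f P R k \<longleftrightarrow>
     uvec R k \<noteq> 0 \<and>
     grad f (xit R k) \<bullet> uvec R k \<le> 0 \<and>
     uvec R k \<bullet> (Bmat R k *v uvec R k)
       \<le> p_kappa_snc P * lambda_min (Bmat R k) * (norm (uvec R k))\<^sup>2 \<and>
     is_arg_min (\<lambda>a. cubic_model f (Bmat R k) (xit R k) (a *\<^sub>R uvec R k) (sig R k))
       (\<lambda>a. 0 \<le> a) (aE R k)"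

definition arc_step3 ::
  "(real^'n \<Rightarrow> real) \<Rightarrow> arc_params \<Rightarrow> ('n::finite) arc_run \<Rightarrow> nat \<Rightarrow> bool" where
  "arc_step3 f P R k \<longleftrightarrow>
     thet R k \<le> p_theta P \<and>
     cubic_model f (Bmat R k) (xit R k) (step R k) (sig R k)
       < cubic_model f (Bmat R k) (xit R k) 0 (sig R k) \<and>
     norm (cubic_model_grad f (Bmat R k) (xit R k) (step R k) (sig R k))
       \<le> thet R k * norm (grad f (xit R k)) \<and>
     (\<not> positive_semidefinite (Bmat R k) \<longrightarrow>
        arc_eigenstep_ok f P R k \<and>
        cubic_model f (Bmat R k) (xit R k) (step R k) (sig R k)
          \<le> cubic_model f (Bmat R k) (xit R k) (eigenstep R k) (sig R k))"

definition arc_unsuccessful4 ::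
  "(real^'n \<Rightarrow> real) \<Rightarrow> arc_params \<Rightarrow> ('n::finite) arc_run \<Rightarrow> nat \<Rightarrow> bool" where
  "arc_unsuccessful4 f P R k \<longleftrightarrow>
     norm (step R k) < 1 \<and> flg R k \<and>
     p_C P > p_alpha P * (1 - p_theta P) * norm (grad f (xit R k))"

definition arc_successful ::
  "(real^'n \<Rightarrow> real) \<Rightarrow> arc_params \<Rightarrow> ('n::finite) arc_run \<Rightarrow> nat \<Rightarrow> bool" where
  "arc_successful f P R k \<longleftrightarrow>
     \<not> arc_unsuccessful4 f P R k \<and> arc_rho f R k \<ge> p_eta1 P"

definition arc_unsuccessful5 ::
  "(real^'n \<Rightarrow> real) \<Rightarrow> arc_params \<Rightarrow> ('n::finite) arc_run \<Rightarrow> nat \<Rightarrow> bool" where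
  "arc_unsuccessful5 f P R k \<longleftrightarrow>
     \<not> arc_unsuccessful4 f P R k \<and> arc_rho f R k < p_eta1 P"

definition arc_update4 ::
  "(real^'n \<Rightarrow> real) \<Rightarrow> arc_params \<Rightarrow> ('n::finite) arc_run \<Rightarrow> nat \<Rightarrow> bool" where
  "arc_update4 f P R k \<longleftrightarrow>
     xit R (Suc k) = xit R k \<and> sig R (Suc k) = sig R k \<and>
     Cacc R (Suc k) = p_alpha P * (1 - p_theta P) * norm (grad f (xit R k)) \<and>
     \<not> flg R (Suc k)"

definition arc_update_successful ::
  "(real^'n \<Rightarrow> real) \<Rightarrow> arc_params \<Rightarrow> ('n::finite) arc_run \<Rightarrow> nat \<Rightarrow> bool" where
  "arc_update_successful f P R k \<longleftrightarrow>
     xit R (Suc k) = xit R k + step R k \<and>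
     (if arc_rho f R k \<ge> p_eta2 P
      then sig R (Suc k) \<in> {max (p_sigma_min P) (p_gamma1 P * sig R k) .. sig R k}
      else sig R (Suc k) \<in> {sig R k .. p_gamma2 P * sig R k}) \<and>
     (if norm (step R k) \<ge> 1
      then Cacc R (Suc k) = p_C P \<and> flg R (Suc k)
      else Cacc R (Suc k)
             = p_alpha P * (1 - p_theta P) * norm (grad f (xit R (Suc k))) \<and>
           \<not> flg R (Suc k))"

definition arc_update_unsuccessful5 :: "arc_params \<Rightarrow> ('n::finite) arc_run \<Rightarrow> nat \<Rightarrow> bool" where
  "arc_update_unsuccessful5 P R k \<longleftrightarrow>
     xit R (Suc k) = xit R k \<and>
     sig R (Suc k) \<in> {p_gamma2 P * sig R k .. p_gamma3 P * sig R k} \<and>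
     Cacc R (Suc k) = Cacc R k \<and> Bmat R (Suc k) = Bmat R k \<and>
     (flg R (Suc k) \<longleftrightarrow> flg R k)"

text \<open>
  The accuracy requirement of Step 2 is imposed at every reached iteration: where Step 2 is
  skipped, the iterate, the matrix and the accuracy level are all inherited, so the requirement
  is inherited too.
\<close>

definition arc_so_run ::
  "(real^'n \<Rightarrow> real) \<Rightarrow> real^'n \<Rightarrow> arc_params \<Rightarrow> real \<Rightarrow> real \<Rightarrow> ('n::finite) arc_run \<Rightarrow> bool" where
  "arc_so_run f x0 P \<epsilon> \<epsilon>H R \<longleftrightarrow>
     xit R 0 = x0 \<and> sig R 0 = p_sigma0 P \<and> Cacc R 0 = p_C P \<and> flg R 0 \<and>
     (\<forall>k. arc_reached f \<epsilon> \<epsilon>H R k \<longrightarrow>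
        transpose (Bmat R k) = Bmat R k \<and>
        mat_norm (hess f (xit R k) - Bmat R k) \<le> Cacc R k) \<and>
     (\<forall>k. arc_executed f \<epsilon> \<epsilon>H R k \<longrightarrow>
        arc_step3 f P R k \<and>
        (arc_unsuccessful4 f P R k \<longrightarrow> arc_update4 f P R k) \<and>
        (arc_successful f P R k \<longrightarrow> arc_update_successful f P R k) \<and>
        (arc_unsuccessful5 f P R k \<longrightarrow> arc_update_unsuccessful5 P R k))"

text \<open>
  This is a separate condition because the updates alone do not enforce the bound
  \<open>C\<close> for long steps: after a short successful step the new accuracy level
  may exceed \<open>C\<close>.
\<close>

definition arc_accuracy ::
  "(real^'n \<Rightarrow> real) \<Rightarrow> arc_params \<Rightarrow> real \<Rightarrow> real \<Rightarrow> ('n::finite) arc_run \<Rightarrow> bool" where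
  "arc_accuracy f P \<epsilon> \<epsilon>H R \<longleftrightarrow>
     (\<forall>k. arc_executed f \<epsilon> \<epsilon>H R k \<and>
          (arc_successful f P R k \<or> arc_unsuccessful5 f P R k) \<longrightarrow>
        (norm (step R k) \<ge> 1 \<longrightarrow>
           mat_norm (hess f (xit R k) - Bmat R k) \<le> p_C P) \<and>
        (norm (step R k) < 1 \<longrightarrow>
           mat_norm (hess f (xit R k) - Bmat R k)
             \<le> p_alpha P * (1 - p_theta P) * norm (grad f (xit R k))))"

definition hess_lipschitz_on_steps ::
  "(real^'n \<Rightarrow> real) \<Rightarrow> real \<Rightarrow> real \<Rightarrow> real \<Rightarrow> ('n::finite) arc_run \<Rightarrow> bool" where
  "hess_lipschitz_on_steps f L \<epsilon> \<epsilon>H R \<longleftrightarrow>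
     (\<forall>k. arc_executed f \<epsilon> \<epsilon>H R k \<longrightarrow>
        (\<forall>\<beta>\<in>{0..1}. mat_norm (hess f (xit R k + \<beta> *\<^sub>R step R k) - hess f (xit R k))
                       \<le> L * \<beta> * norm (step R k)))"

definition hess_bounded_on_steps ::
  "(real^'n \<Rightarrow> real) \<Rightarrow> real \<Rightarrow> real \<Rightarrow> real \<Rightarrow> ('n::finite) arc_run \<Rightarrow> bool" where
  "hess_bounded_on_steps f \<kappa>H \<epsilon> \<epsilon>H R \<longleftrightarrow>
     (\<forall>k. arc_executed f \<epsilon> \<epsilon>H R k \<longrightarrow>
        (\<forall>\<beta>\<in>{0..1}. mat_norm (hess f (xit R k + \<beta> *\<^sub>R step R k)) \<le> \<kappa>H))"

definition B_bounded ::
  "(real^'n \<Rightarrow> real) \<Rightarrow> real \<Rightarrow> real \<Rightarrow> real \<Rightarrow> ('n::finite) arc_run \<Rightarrow> bool" where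
  "B_bounded f \<kappa>B \<epsilon> \<epsilon>H R \<longleftrightarrow>
     (\<forall>k. arc_reached f \<epsilon> \<epsilon>H R k \<longrightarrow> mat_norm (Bmat R k) \<le> \<kappa>B)"

definition step_condition_a ::
  "(real^'n \<Rightarrow> real) \<Rightarrow> arc_params \<Rightarrow> real \<Rightarrow> real \<Rightarrow> ('n::finite) arc_run \<Rightarrow> bool" where
  "step_condition_a f P \<epsilon> \<epsilon>H R \<longleftrightarrow>
     (\<forall>k. arc_executed f \<epsilon> \<epsilon>H R k \<longrightarrow>
        norm (cubic_model_grad f (Bmat R k) (xit R k) (step R k) (sig R k))
          \<le> p_theta P * min ((norm (step R k))\<^sup>2) (norm (grad f (xit R k))))"

definition step_condition_b ::
  "(real^'n \<Rightarrow> real) \<Rightarrow> arc_params \<Rightarrow> real \<Rightarrow> real \<Rightarrow> ('n::finite) arc_run \<Rightarrow> bool" where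
  "step_condition_b f P \<epsilon> \<epsilon>H R \<longleftrightarrow>
     (\<forall>k. arc_executed f \<epsilon> \<epsilon>H R k \<longrightarrow>
        norm (cubic_model_grad f (Bmat R k) (xit R k) (step R k) (sig R k))
          \<le> p_theta P * min 1 (norm (step R k)) * norm (grad f (xit R k)))"

end

theory Submission
  imports Defs
begin

text \<open>
  The proof is an amortized count of iterations. Norms are Euclidean or operator norms, and \<open>M\<close> is the
  maximum of \<open>\<epsilon> powr (-3/2)\<close> and \<open>\<epsilon>H powr (-3)\<close>.

  \<^emph>\<open>The regularization parameter stays bounded.\<close> At the step the model gradient is at most
  \<open>\<theta> \<parallel>\<nabla>f(x\<^sub>k)\<parallel>\<close>, so
  \<open>(1 - \<theta>) \<parallel>\<nabla>f(x\<^sub>k)\<parallel> \<le> (\<parallel>B\<^sub>k\<parallel> + \<sigma>\<^sub>k \<parallel>s\<^sub>k\<parallel>) \<parallel>s\<^sub>k\<parallel>\<close> (\<open>grad_le_step\<close>).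
  For short steps the admissible Hessian error \<open>\<alpha> (1 - \<theta>) \<parallel>\<nabla>f(x\<^sub>k)\<parallel>\<close> is therefore at most a multiple
  of \<open>\<parallel>s\<^sub>k\<parallel>\<close>; for long steps the constant error \<open>C\<close> trivially is. In both cases
  \<open>f(x\<^sub>k + s\<^sub>k)\<close> exceeds the quadratic model by at most a multiple of \<open>\<parallel>s\<^sub>k\<parallel>\<^sup>3\<close>, while the model
  decreases by at least \<open>\<sigma>\<^sub>k/3 \<parallel>s\<^sub>k\<parallel>\<^sup>3\<close>. The multiple for short steps contains the term
  \<open>\<alpha>/2 \<sigma>\<^sub>k\<close>, which is where the condition \<open>\<eta>\<^sub>2 < 1 - 3\<alpha>/2\<close> comes from: under it, every large
  \<open>\<sigma>\<^sub>k\<close> makes the iteration very successful (\<open>very_successful\<close>), so \<open>\<sigma>\<^sub>k\<close> stays between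
  \<open>\<sigma>_min\<close> and a bound \<open>\<sigma>_max\<close> independent of the tolerances (\<open>sig_bounds\<close>).

  \<^emph>\<open>Two kinds of successful iterations decrease the objective by at least c/M.\<close> Here \<open>c\<close> is a
  constant independent of the tolerances. If \<open>\<parallel>\<nabla>f(x\<^sub>k\<^sub>+\<^sub>1)\<parallel> > \<epsilon>\<close>, then the same estimates
  bound \<open>\<parallel>s\<^sub>k\<parallel>\<^sup>2\<close> below by a multiple of \<open>\<epsilon>\<close>, and the cubic term yields a decrease of order
  \<open>\<epsilon> powr (3/2)\<close> (\<open>decrease_if_next_grad_large\<close>). If \<open>lambda_min B\<^sub>k < - \<epsilon>H\<close>, then comparison with
  the eigenstep yields a decrease of order \<open>\<epsilon>H\<^sup>3\<close> (\<open>decrease_if_negative_curvature\<close>).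

  \<^emph>\<open>Every other successful iteration, except possibly the last, is paid for by the next one.\<close> It lands
  at a point with \<open>\<parallel>\<nabla>f\<parallel> \<le> \<epsilon>\<close>. As long as the algorithm stays there without stopping,
  \<open>lambda_min B\<^sub>j < - \<epsilon>H\<close>, so the next successful iteration is of the second kind. Charging two
  iterations to each guaranteed decrease bounds the number of successful iterations by
  \<open>2 (f(x\<^sub>0) - f_low) M / c + 1\<close> (\<open>n_succ_potential\<close>).

  \<^emph>\<open>Unsuccessful iterations.\<close> Those of Step 4 clear the flag, which only a successful iteration sets
  again (\<open>n_unsucc4_bound\<close>). Those of Step 5 multiply \<open>\<sigma>\<^sub>k\<close> by at least \<open>\<gamma>\<^sub>2\<close>, a successful
  iteration multiplies it by at least \<open>\<gamma>\<^sub>1\<close>, and \<open>\<sigma>\<^sub>k\<close> is bounded; taking logarithms bounds the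
  number of the former linearly by the number of the latter (\<open>n_unsucc5_potential\<close>).
\<close>

section \<open>Gradients, Hessians and matrix norms\<close>

lemma grad_eqI:
  assumes "GDERIV F x :> D"
  shows "grad F x = D"
proof -
  have "E = D" if "GDERIV F x :> E" for E
  proof -
    have "(\<lambda>h. h \<bullet> E) = (\<lambda>h. h \<bullet> D)"
      using has_derivative_unique that assms unfolding gderiv_def by blast
    then show "E = D"
      by (metis inner_commute vector_eq_rdot)
  qed
  then show ?thesis
    unfolding grad_def using assms by blast
qed

lemma GDERIV_grad:
  fixes F :: "real^'n \<Rightarrow> real"
  assumes "F differentiable (at x)"
  shows "GDERIV F x :> grad F x"
proof -
  obtain F' where F': "(F has_derivative F') (at x)"
    using assms by (auto simp: differentiable_def)
  have "F' h = h \<bullet> adjoint F' 1" for h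
    using adjoint_works[OF has_derivative_linear[OF F'], of h 1] by simp
  then have "F' = (\<lambda>h. h \<bullet> adjoint F' 1)" by blast
  then have "GDERIV F x :> adjoint F' 1"
    using F' unfolding gderiv_def by simp
  then show ?thesis
    using grad_eqI by metis
qed

lemma norm_mult_le_mat_norm: "norm (A *v v) \<le> mat_norm A * norm v"
  unfolding mat_norm_def by (rule onorm) simp

lemma quadratic_form_le_mat_norm: "v \<bullet> (A *v v) \<le> mat_norm A * (norm v)\<^sup>2"
proof -
  have "v \<bullet> (A *v v) \<le> norm v * norm (A *v v)" by (rule norm_cauchy_schwarz)
  also have "\<dots> \<le> norm v * (mat_norm A * norm v)"
    by (intro mult_left_mono norm_mult_le_mat_norm) simp
  finally show ?thesis by (simp add: power2_eq_square algebra_simps)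
qed

lemma mat_norm_nonneg: "0 \<le> mat_norm A"
  unfolding mat_norm_def by (rule onorm_pos_le) simp

lemma symmetric_inner_commute:
  fixes B :: "real^'n^'n"
  assumes "transpose B = B"
  shows "v \<bullet> (B *v w) = w \<bullet> (B *v v)"
  by (metis assms dot_lmul_matrix inner_commute transpose_matrix_vector)

lemma twice_cont_diffD:
  assumes "twice_cont_diff f"
  shows twice_cont_diff_GDERIV: "GDERIV f x :> grad f x"
    and twice_cont_diff_hess: "(grad f has_derivative (\<lambda>h. hess f x *v h)) (at x)"
  using assms GDERIV_grad jacobian_works unfolding twice_cont_diff_def hess_def by blast+

lemma has_derivative_along_line:
  assumes "twice_cont_diff f"
  shows "((\<lambda>t. f (x + t *\<^sub>R s)) has_real_derivative grad f (x + t *\<^sub>R s) \<bullet> s) (at t)"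
proof -
  have "((\<lambda>t. x + t *\<^sub>R s) has_derivative (\<lambda>h. h *\<^sub>R s)) (at t)"
    by (auto intro!: derivative_eq_intros)
  moreover have "(f has_derivative (\<lambda>h. h \<bullet> grad f (x + t *\<^sub>R s))) (at (x + t *\<^sub>R s))"
    using twice_cont_diff_GDERIV[OF assms] unfolding gderiv_def by blast
  ultimately have "((\<lambda>t. f (x + t *\<^sub>R s)) has_derivative
      (\<lambda>h. (h *\<^sub>R s) \<bullet> grad f (x + t *\<^sub>R s))) (at t)"
    using has_derivative_compose by blast
  then show ?thesis
    by (rule has_derivative_imp_has_field_derivative) (simp add: inner_commute)
qed

lemma grad_has_derivative_along_line:
  assumes "twice_cont_diff f"
  shows "((\<lambda>t. grad f (x + t *\<^sub>R s)) has_derivative (\<lambda>h. h *\<^sub>R (hess f (x + t *\<^sub>R s) *v s))) (at t)"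
proof -
  have "((\<lambda>t. x + t *\<^sub>R s) has_derivative (\<lambda>h. h *\<^sub>R s)) (at t)"
    by (auto intro!: derivative_eq_intros)
  from has_derivative_compose[OF this twice_cont_diff_hess[OF assms]]
  show ?thesis
    by (simp add: matrix_vector_mult_scaleR)
qed

section \<open>Taylor estimates under a Lipschitz condition on a segment\<close>

definition hess_lipschitz_segment ::
  "(real^'n \<Rightarrow> real) \<Rightarrow> real \<Rightarrow> real^'n \<Rightarrow> real^'n \<Rightarrow> bool" where
  "hess_lipschitz_segment f L x s \<longleftrightarrow>
     (\<forall>t\<in>{0..1}. mat_norm (hess f (x + t *\<^sub>R s) - hess f x) \<le> L * t * norm s)"

lemma grad_taylor:
  assumes f: "twice_cont_diff f" and L: "0 \<le> L" "hess_lipschitz_segment f L x s"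
    and t: "t \<in> {0..1}"
  shows "norm (grad f (x + t *\<^sub>R s) - grad f x - t *\<^sub>R (hess f x *v s)) \<le> L * (norm s)\<^sup>2"
proof -
  define D where "D = (\<lambda>t. grad f (x + t *\<^sub>R s) - t *\<^sub>R (hess f x *v s))"
  define D' where "D' = (\<lambda>t h::real. h *\<^sub>R ((hess f (x + t *\<^sub>R s) - hess f x) *v s))"
  have "(D has_derivative D' u) (at u within {0..1})" for u
    unfolding D_def D'_def
    by (rule has_derivative_at_withinI)
       (auto intro!: derivative_eq_intros grad_has_derivative_along_line[OF f]
          simp: algebra_simps)
  moreover have "onorm (D' u) \<le> L * (norm s)\<^sup>2" if u: "u \<in> {0..1}" for u
  proof (rule onorm_le)
    fix h
    have "norm ((hess f (x + u *\<^sub>R s) - hess f x) *v s) \<le> (L * u * norm s) * norm s"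
      using norm_mult_le_mat_norm L(2) u unfolding hess_lipschitz_segment_def
      by (meson mult_right_mono norm_ge_zero order_trans)
    also have "\<dots> \<le> (L * 1 * norm s) * norm s"
      using u L(1) by (intro mult_right_mono mult_left_mono) auto
    finally have *: "norm ((hess f (x + u *\<^sub>R s) - hess f x) *v s) \<le> L * (norm s)\<^sup>2"
      by (simp add: power2_eq_square)
    show "norm (D' u h) \<le> L * (norm s)\<^sup>2 * norm h"
      using mult_left_mono[OF *, of "\<bar>h\<bar>"] by (simp add: D'_def mult.commute)
  qed
  ultimately have "norm (D t - D 0) \<le> L * (norm s)\<^sup>2 * norm (t - 0)"
    using t by (intro differentiable_bound[of "{0..1}" D D']) auto
  also have "\<dots> \<le> L * (norm s)\<^sup>2"
    using t L(1) by (simp add: mult_left_le)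
  finally show ?thesis
    by (simp add: D_def algebra_simps)
qed

text \<open>
  The quadratic term has to carry the exact factor \<open>1/2\<close>, since the threshold for \<open>\<eta>\<^sub>2\<close> depends
  on it. The constant in front of the cubic term is immaterial, so the mean value theorem with the constant
  \<open>L\<close> suffices instead of the sharp \<open>L/6\<close>.
\<close>

lemma taylor2_upper:
  assumes f: "twice_cont_diff f" and L: "0 \<le> L" "hess_lipschitz_segment f L x s"
  shows "f (x + s) \<le> taylor2 f B x s
           + mat_norm (hess f x - B) / 2 * (norm s)\<^sup>2 + L * norm s ^ 3"
proof -
  define \<psi> where "\<psi> = (\<lambda>t. f (x + t *\<^sub>R s) - t * (grad f x \<bullet> s) - t\<^sup>2 / 2 * (s \<bullet> (hess f x *v s)))"
  define \<psi>' where "\<psi>' = (\<lambda>t. grad f (x + t *\<^sub>R s) \<bullet> s - grad f x \<bullet> s - t * (s \<bullet> (hess f x *v s)))"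
  have "DERIV \<psi> t :> \<psi>' t" for t
    unfolding \<psi>_def \<psi>'_def
    by (auto intro!: derivative_eq_intros has_derivative_along_line[OF f])
  then obtain t where t: "0 < t" "t < 1" "\<psi> 1 - \<psi> 0 = (1 - 0) * \<psi>' t"
    using MVT2[of 0 1 \<psi> \<psi>'] by auto
  have "\<psi>' t = (grad f (x + t *\<^sub>R s) - grad f x - t *\<^sub>R (hess f x *v s)) \<bullet> s"
    by (simp add: \<psi>'_def inner_diff_left inner_commute[of _ s] inner_diff_right)
  also have "\<dots> \<le> norm (grad f (x + t *\<^sub>R s) - grad f x - t *\<^sub>R (hess f x *v s)) * norm s"
    by (rule norm_cauchy_schwarz)
  also have "\<dots> \<le> (L * (norm s)\<^sup>2) * norm s"
    using grad_taylor[OF f L] t by (intro mult_right_mono) auto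
  finally have "\<psi>' t \<le> L * norm s ^ 3"
    by (simp add: power2_eq_square power3_eq_cube)
  moreover have "\<psi> 1 - \<psi> 0 = f (x + s) - f x - grad f x \<bullet> s - (s \<bullet> (hess f x *v s)) / 2"
    by (simp add: \<psi>_def)
  moreover have "s \<bullet> (hess f x *v s) = s \<bullet> (B *v s) + s \<bullet> ((hess f x - B) *v s)"
    by (simp add: matrix_vector_mult_diff_rdistrib inner_diff_right)
  moreover have "s \<bullet> ((hess f x - B) *v s) \<le> mat_norm (hess f x - B) * (norm s)\<^sup>2"
    by (rule quadratic_form_le_mat_norm)
  moreover have "mat_norm (hess f x - B) / 2 * (norm s)\<^sup>2 = (mat_norm (hess f x - B) * (norm s)\<^sup>2) / 2"
    by simp
  moreover have "\<psi> 1 - \<psi> 0 = \<psi>' t" using t(3) by simp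
  ultimately show ?thesis
    unfolding taylor2_def by linarith
qed

section \<open>The smallest eigenvalue of a symmetric matrix\<close>

text \<open>
  Eigenvectors for distinct eigenvalues are orthogonal, hence linearly independent. Together with the next
  lemma this shows that the minimum in \<open>lambda_min\<close> is attained.
\<close>

lemma symmetric_finite_eigenvalues:
  fixes B :: "real^'n^'n"
  assumes "transpose B = B"
  shows "finite {l. \<exists>v. v \<noteq> 0 \<and> B *v v = l *\<^sub>R v}"
proof -
  define E where "E = {l. \<exists>v. v \<noteq> 0 \<and> B *v v = l *\<^sub>R v}"
  have "\<forall>l\<in>E. \<exists>v. v \<noteq> 0 \<and> B *v v = l *\<^sub>R v"
    unfolding E_def by blast
  then obtain v where "\<forall>l\<in>E. v l \<noteq> 0 \<and> B *v v l = l *\<^sub>R v l"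
    by metis
  then have v: "v l \<noteq> 0" "B *v v l = l *\<^sub>R v l" if "l \<in> E" for l
    using that by blast+
  have orth: "v l \<bullet> v m = 0" if "l \<in> E" "m \<in> E" "l \<noteq> m" for l m
  proof -
    have "v l \<bullet> (m *\<^sub>R v m) = v m \<bullet> (l *\<^sub>R v l)"
      using symmetric_inner_commute[OF assms, of "v l" "v m"] v that by simp
    then show ?thesis
      using that(3) by (simp add: inner_commute)
  qed
  have inj: "inj_on v E"
    using orth v(1) by (metis inj_onI inner_eq_zero_iff)
  have "pairwise orthogonal (v ` E)"
    using orth by (force simp: pairwise_def orthogonal_def)
  moreover have "0 \<notin> v ` E"
    using v(1) by (metis imageE)
  ultimately have "finite (v ` E)"
    by (intro independent_imp_finite pairwise_orthogonal_independent)
  with inj show ?thesis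
    unfolding E_def using finite_image_iff by blast
qed

text \<open>
  A minimizer \<open>v\<close> of the Rayleigh quotient is an eigenvector: with \<open>l\<close> its value, \<open>A = B - l I\<close> is
  positive semidefinite and \<open>v \<bullet> A v = 0\<close>, and perturbing \<open>v\<close> in the direction \<open>w = A v\<close>
  shows that \<open>w\<close> vanishes.
\<close>

lemma symmetric_eigenvector_exists:
  fixes B :: "real^'n^'n"
  assumes sym: "transpose B = B"
  obtains v l where "v \<noteq> 0" "B *v v = l *\<^sub>R v"
proof -
  have "compact (sphere (0::real^'n) 1)" "sphere (0::real^'n) 1 \<noteq> {}"
    by auto
  moreover have "continuous_on (sphere (0::real^'n) 1) (\<lambda>v. v \<bullet> (B *v v))"
    by (intro continuous_intros linear_continuous_on) simp
  ultimately obtain v where v: "norm v = 1"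
    and min: "\<And>w. norm w = 1 \<Longrightarrow> v \<bullet> (B *v v) \<le> w \<bullet> (B *v w)"
    using continuous_attains_inf[of "sphere (0::real^'n) 1" "\<lambda>v. v \<bullet> (B *v v)"] by auto
  define l where "l = v \<bullet> (B *v v)"
  define A where "A = (\<lambda>w. B *v w - l *\<^sub>R w)"
  have vv: "v \<bullet> v = 1"
    using v by (simp add: norm_eq_1)
  have psd: "0 \<le> w \<bullet> A w" for w
  proof (cases "w = 0")
    case False
    have "l \<le> (w /\<^sub>R norm w) \<bullet> (B *v (w /\<^sub>R norm w))"
      unfolding l_def by (rule min) (use False in simp)
    also have "\<dots> = (w \<bullet> (B *v w)) / (norm w)\<^sup>2"
      by (simp add: matrix_vector_mult_scaleR power2_eq_square divide_inverse)
    finally have "l * (w \<bullet> w) \<le> w \<bullet> (B *v w)"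
      using False by (simp add: field_simps power2_norm_eq_inner)
    then show ?thesis
      by (simp add: A_def inner_diff_right)
  qed (simp add: A_def)
  define w where "w = A v"
  have ww: "v \<bullet> A v = 0"
    using vv by (simp add: A_def inner_diff_right l_def)
  have "v \<bullet> A w = w \<bullet> A v"
    using symmetric_inner_commute[OF sym, of v w]
    by (simp add: A_def inner_diff_right inner_commute)
  then have cross: "v \<bullet> A w = w \<bullet> w"
    by (simp add: w_def)
  have quad: "0 \<le> 2 * t * (w \<bullet> w) + t\<^sup>2 * (w \<bullet> A w)" for t
  proof -
    have "A (v + t *\<^sub>R w) = A v + t *\<^sub>R A w"
      by (simp add: A_def algebra_simps matrix_vector_right_distrib matrix_vector_mult_scaleR)
    then have "(v + t *\<^sub>R w) \<bullet> A (v + t *\<^sub>R w) = v \<bullet> A v + t * (v \<bullet> A w) + t * (w \<bullet> A v) + t\<^sup>2 * (w \<bullet> A w)"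
      by (simp add: inner_add_left inner_add_right power2_eq_square algebra_simps)
    then show ?thesis
      using psd[of "v + t *\<^sub>R w"] ww cross by (simp add: w_def)
  qed
  have "w \<bullet> w = 0"
  proof (rule ccontr)
    assume "w \<bullet> w \<noteq> 0"
    then have pos: "0 < w \<bullet> w" by simp
    \<comment> \<open>The quadratic in \<open>t\<close> is minimal at \<open>- (w \<bullet> w) / (w \<bullet> A w)\<close>; adding \<open>1\<close> covers a vanishing denominator.\<close>
    define q where "q = w \<bullet> A w + 1"
    have q: "q > 0" using psd[of w] by (simp add: q_def)
    have "0 \<le> 2 * (- (w \<bullet> w) / q) * (w \<bullet> w) + (- (w \<bullet> w) / q)\<^sup>2 * (q - 1)"
      using quad[of "- (w \<bullet> w) / q"] by (simp add: q_def)
    also have "\<dots> = - ((w \<bullet> w)\<^sup>2 / q) - ((w \<bullet> w) / q)\<^sup>2"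
      using q by (simp add: field_simps power2_eq_square)
    also have "\<dots> < 0"
    proof -
      have "0 < (w \<bullet> w)\<^sup>2 / q" using q pos by (intro divide_pos_pos) simp_all
      then show ?thesis by (smt (verit) zero_le_power2)
    qed
    finally show False by simp
  qed
  then have "B *v v = l *\<^sub>R v"
    by (simp add: w_def A_def)
  moreover have "v \<noteq> 0" using v by auto
  ultimately show thesis using that by blast
qed

lemma lambda_min_neg_not_psd:
  fixes B :: "real^'n^'n"
  assumes "transpose B = B" "lambda_min B < 0"
  shows "\<not> positive_semidefinite B"
proof -
  let ?E = "{l. \<exists>v. v \<noteq> 0 \<and> B *v v = l *\<^sub>R v}"
  have "?E \<noteq> {}"
    using symmetric_eigenvector_exists[OF assms(1)] by blast
  then have "lambda_min B \<in> ?E"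
    unfolding lambda_min_def using Min_in symmetric_finite_eigenvalues[OF assms(1)] by blast
  then obtain v where v: "v \<noteq> 0" "B *v v = lambda_min B *\<^sub>R v" by blast
  then have "v \<bullet> (B *v v) = lambda_min B * (v \<bullet> v)" by simp
  also have "\<dots> < 0" using assms(2) v(1) by (simp add: mult_neg_pos)
  finally show ?thesis
    unfolding positive_semidefinite_def using linorder_not_le by blast
qed

section \<open>The cubic model\<close>

lemma cubic_model_grad_eq:
  fixes B :: "real^'n^'n"
  assumes sym: "transpose B = B" and "s \<noteq> 0"
  shows "cubic_model_grad f B x s \<sigma> = grad f x + B *v s + (\<sigma> * norm s) *\<^sub>R s"
proof -
  have B: "((*v) B has_derivative (*v) B) (at s)"
    by (rule bounded_linear_imp_has_derivative) simp
  have "((\<lambda>t. cubic_model f B x t \<sigma>) has_derivative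
      (\<lambda>h. h \<bullet> (grad f x + B *v s + (\<sigma> * norm s) *\<^sub>R s))) (at s)"
    unfolding cubic_model_def taylor2_def
    apply (rule derivative_eq_intros B has_derivative_norm[OF assms(2)] refl)+
    using assms(2)
    apply (simp add: fun_eq_iff inner_add_right inner_commute[of _ "grad f x"]
        symmetric_inner_commute[OF sym, of s] sgn_div_norm power2_eq_square field_simps)
    done
  then show ?thesis
    unfolding cubic_model_grad_def by (intro grad_eqI) (simp add: gderiv_def)
qed

lemma taylor2_zero [simp]: "taylor2 f B x 0 = f x"
  by (simp add: taylor2_def)

lemma cubic_model_zero [simp]: "cubic_model f B x 0 \<sigma> = f x"
  by (simp add: cubic_model_def)

lemma model_decrease_taylor2:
  assumes "cubic_model f B x s \<sigma> \<le> f x - d"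
  shows "d + \<sigma> / 3 * norm s ^ 3 \<le> f x - taylor2 f B x s"
  using assms by (simp add: cubic_model_def)

text \<open>
  The model gradient is \<open>\<nabla>f(x) + B s + \<sigma> \<parallel>s\<parallel> s\<close>, so when it is small compared with
  \<open>\<nabla>f(x)\<close>, the terms in \<open>s\<close> must balance the gradient. This turns an accuracy proportional
  to the gradient into one proportional to the step.
\<close>

lemma grad_le_step:
  fixes B :: "real^'n^'n"
  assumes sym: "transpose B = B" and s: "s \<noteq> 0" and \<sigma>: "0 \<le> \<sigma>" and B: "mat_norm B \<le> \<kappa>"
    and stationary: "norm (cubic_model_grad f B x s \<sigma>) \<le> \<theta> * norm (grad f x)"
  shows "(1 - \<theta>) * norm (grad f x) \<le> (\<kappa> + \<sigma> * norm s) * norm s"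
proof -
  let ?m = "cubic_model_grad f B x s \<sigma>"
  have "grad f x = ?m - B *v s - (\<sigma> * norm s) *\<^sub>R s"
    by (simp add: cubic_model_grad_eq[OF sym s])
  from arg_cong[OF this, of norm]
  have "norm (grad f x) \<le> norm ?m + norm (B *v s) + norm ((\<sigma> * norm s) *\<^sub>R s)"
    using norm_triangle_ineq4[of "?m - B *v s" "(\<sigma> * norm s) *\<^sub>R s"]
      norm_triangle_ineq4[of ?m "B *v s"] by linarith
  moreover have "norm (B *v s) \<le> \<kappa> * norm s"
    using norm_mult_le_mat_norm B by (meson mult_right_mono norm_ge_zero order_trans)
  moreover have "norm ((\<sigma> * norm s) *\<^sub>R s) = \<sigma> * norm s * norm s"
    using \<sigma> by simp
  ultimately have "norm (grad f x) \<le> \<theta> * norm (grad f x) + \<kappa> * norm s + \<sigma> * norm s * norm s"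
    using stationary by linarith
  then show ?thesis by (simp add: algebra_simps)
qed

lemma grad_le_short_step:
  fixes B :: "real^'n^'n"
  assumes "transpose B = B" "s \<noteq> 0" "0 \<le> \<sigma>" "mat_norm B \<le> \<kappa>"
    and "norm (cubic_model_grad f B x s \<sigma>) \<le> \<theta> * norm (grad f x)" and "norm s \<le> 1"
  shows "(1 - \<theta>) * norm (grad f x) \<le> (\<kappa> + \<sigma>) * norm s"
proof -
  have "(\<kappa> + \<sigma> * norm s) * norm s \<le> (\<kappa> + \<sigma>) * norm s"
    using assms by (intro mult_right_mono add_left_mono mult_left_le) auto
  with grad_le_step[OF assms(1-5)] show ?thesis by linarith
qed

text \<open>
  The decrease is that of the step of length \<open>\<tau>/\<sigma>\<close> along \<open>u\<close>, which balances the negative curvature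
  \<open>- \<tau>\<close> against the cubic term; the global minimizer along the ray is at least as good.
\<close>

lemma eigenstep_decrease:
  fixes B :: "real^'n^'n"
  assumes u: "u \<noteq> 0" "grad f x \<bullet> u \<le> 0" "u \<bullet> (B *v u) \<le> - \<tau> * (norm u)\<^sup>2"
    and pos: "0 \<le> \<tau>" "0 < \<sigma>"
    and min: "is_arg_min (\<lambda>a. cubic_model f B x (a *\<^sub>R u) \<sigma>) (\<lambda>a. 0 \<le> a) a\<^sub>0"
  shows "cubic_model f B x (a\<^sub>0 *\<^sub>R u) \<sigma> \<le> f x - \<tau> ^ 3 / (6 * \<sigma>\<^sup>2)"
proof -
  define a where "a = \<tau> / (\<sigma> * norm u)"
  have a: "0 \<le> a" "a * norm u = \<tau> / \<sigma>"
    using u pos by (simp_all add: a_def)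
  have "cubic_model f B x (a\<^sub>0 *\<^sub>R u) \<sigma> \<le> cubic_model f B x (a *\<^sub>R u) \<sigma>"
    using min a(1) by (auto simp: is_arg_min_linorder)
  also have "\<dots> = f x + a * (grad f x \<bullet> u) + a\<^sup>2 / 2 * (u \<bullet> (B *v u)) + \<sigma> / 3 * (a * norm u) ^ 3"
    using a(1) by (simp add: cubic_model_def taylor2_def matrix_vector_mult_scaleR power2_eq_square)
  also have "\<dots> \<le> f x + 0 + a\<^sup>2 / 2 * (- \<tau> * (norm u)\<^sup>2) + \<sigma> / 3 * (a * norm u) ^ 3"
  proof -
    have "a * (grad f x \<bullet> u) \<le> 0"
      using a(1) u(2) by (rule mult_nonneg_nonpos)
    moreover have "a\<^sup>2 / 2 * (u \<bullet> (B *v u)) \<le> a\<^sup>2 / 2 * (- \<tau> * (norm u)\<^sup>2)"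
      using u(3) by (rule mult_left_mono) simp
    ultimately show ?thesis by linarith
  qed
  also have "\<dots> = f x - \<tau> / 2 * (a * norm u)\<^sup>2 + \<sigma> / 3 * (a * norm u) ^ 3"
    by (simp add: power_mult_distrib)
  also have "\<dots> = f x - \<tau> ^ 3 / (6 * \<sigma>\<^sup>2)"
    unfolding a(2) using pos by (simp add: field_simps power2_eq_square power3_eq_cube)
  finally show ?thesis .
qed

section \<open>Constants independent of the tolerances\<close>

text \<open>
  The level of \<open>\<sigma>\<^sub>k\<close> from which on every iteration reaching Step 5 is very successful. The denominator is
  positive by the upper bound on \<open>\<eta>\<^sub>2\<close>.
\<close>

definition sigma_large :: "arc_params \<Rightarrow> real \<Rightarrow> real \<Rightarrow> real" where
  "sigma_large P L \<kappa> = 3 * (p_C P + \<kappa> + 2 * L) / (2 - 3 * p_alpha P - 2 * p_eta2 P)"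

definition sigma_max :: "arc_params \<Rightarrow> real \<Rightarrow> real \<Rightarrow> real" where
  "sigma_max P L \<kappa> = max (p_sigma0 P) (p_gamma3 P * sigma_large P L \<kappa>)"

text \<open>
  The factor \<open>\<zeta>\<close> in \<open>\<parallel>\<nabla>f(x\<^sub>k\<^sub>+\<^sub>1)\<parallel> \<le> \<zeta> \<parallel>s\<^sub>k\<parallel>\<^sup>2\<close> after a short successful step. The
  summands collect the Taylor remainder, the cubic term, the Hessian error, and the model gradient under
  either of the two step conditions; the summand \<open>1\<close> bounds \<open>\<theta>\<close> and also makes \<open>\<zeta> \<ge> 1\<close>, so
  that long steps need no separate constant.
\<close>

definition grad_const :: "arc_params \<Rightarrow> real \<Rightarrow> real \<Rightarrow> real" where
  "grad_const P L \<kappa> = 1 + L + sigma_max P L \<kappa>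
     + (p_alpha P + p_theta P / (1 - p_theta P)) * (\<kappa> + sigma_max P L \<kappa>)"

text \<open>
  The guaranteed decrease of the objective per unit of \<open>\<epsilon> powr (3/2)\<close> when the new gradient is large, and
  per unit of \<open>\<epsilon>H\<^sup>3\<close> when the curvature is negative.
\<close>

definition decrease_const :: "arc_params \<Rightarrow> real \<Rightarrow> real \<Rightarrow> real" where
  "decrease_const P L \<kappa> =
     p_eta1 P * min (p_sigma_min P / 3 * grad_const P L \<kappa> powr (-3/2))
                    (p_kappa_snc P ^ 3 / (6 * (sigma_max P L \<kappa>)\<^sup>2))"

section \<open>Executions of the algorithm\<close>

locale arc_so_execution =
  fixes f :: "real^'n \<Rightarrow> real" and x0 :: "real^'n" and P :: arc_params
    and L \<kappa> \<epsilon> \<epsilon>H :: real and R :: "'n arc_run"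
  assumes smooth: "twice_cont_diff f"
    and params: "arc_params_ok P"
    and L_pos: "0 < L" and \<kappa>_nonneg: "0 \<le> \<kappa>"
    and tol: "0 < \<epsilon>" "\<epsilon> \<le> 1" "0 < \<epsilon>H" "\<epsilon>H \<le> 1"
    and run: "arc_so_run f x0 P \<epsilon> \<epsilon>H R"
    and accuracy: "arc_accuracy f P \<epsilon> \<epsilon>H R"
    and lipschitz: "hess_lipschitz_on_steps f L \<epsilon> \<epsilon>H R"
    and B_bound: "B_bounded f \<kappa> \<epsilon> \<epsilon>H R"
    and step_condition: "step_condition_a f P \<epsilon> \<epsilon>H R \<or> step_condition_b f P \<epsilon> \<epsilon>H R"
begin

abbreviation reached where "reached \<equiv> arc_reached f \<epsilon> \<epsilon>H R"
abbreviation executed where "executed \<equiv> arc_executed f \<epsilon> \<epsilon>H R"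
abbreviation successful where "successful \<equiv> arc_successful f P R"
abbreviation unsuccessful4 where "unsuccessful4 \<equiv> arc_unsuccessful4 f P R"
abbreviation unsuccessful5 where "unsuccessful5 \<equiv> arc_unsuccessful5 f P R"
abbreviation \<sigma>_max where "\<sigma>_max \<equiv> sigma_max P L \<kappa>"
abbreviation \<zeta> where "\<zeta> \<equiv> grad_const P L \<kappa>"
abbreviation c where "c \<equiv> decrease_const P L \<kappa>"

lemma par:
  "0 < p_sigma0 P" "0 < p_theta P" "p_theta P < 1" "0 \<le> p_alpha P" "p_alpha P < 2/3"
  "0 < p_sigma_min P" "p_sigma_min P \<le> p_sigma0 P" "0 < p_eta1 P" "p_eta1 P \<le> p_eta2 P"
  "0 < 2 - 3 * p_alpha P - 2 * p_eta2 P" "0 < p_gamma1 P" "p_gamma1 P < 1" "1 < p_gamma2 P"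
  "p_gamma2 P < p_gamma3 P" "0 < p_C P" "0 < p_kappa_snc P"
  using params unfolding arc_params_ok_def by auto

lemma executed_reached: "executed k \<Longrightarrow> reached k"
  by (simp add: arc_reached_def arc_executed_def)

lemma reached_Suc: "reached (Suc k) \<longleftrightarrow> executed k"
  by (simp add: arc_reached_def arc_executed_def less_Suc_eq_le)

lemma iteration_cases:
  obtains "successful k" "\<not> unsuccessful4 k" "\<not> unsuccessful5 k"
    | "unsuccessful4 k" "\<not> successful k" "\<not> unsuccessful5 k"
    | "unsuccessful5 k" "\<not> successful k" "\<not> unsuccessful4 k"
  unfolding arc_successful_def arc_unsuccessful5_def by fastforce

context
  fixes k
  assumes ex: "executed k"
begin

lemma step3: "arc_step3 f P R k"
  and update4: "unsuccessful4 k \<Longrightarrow> arc_update4 f P R k"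
  and update_successful: "successful k \<Longrightarrow> arc_update_successful f P R k"
  and update5: "unsuccessful5 k \<Longrightarrow> arc_update_unsuccessful5 P R k"
  and symB: "transpose (Bmat R k) = Bmat R k"
  and normB: "mat_norm (Bmat R k) \<le> \<kappa>"
  using run B_bound ex executed_reached unfolding arc_so_run_def B_bounded_def by blast+

lemma lipschitz_step: "hess_lipschitz_segment f L (xit R k) (step R k)"
  using lipschitz ex unfolding hess_lipschitz_on_steps_def hess_lipschitz_segment_def by blast

lemma step_nonzero: "step R k \<noteq> 0"
  using step3 unfolding arc_step3_def by force

lemma model_stationarity:
  "norm (cubic_model_grad f (Bmat R k) (xit R k) (step R k) (sig R k))
     \<le> p_theta P * norm (grad f (xit R k))"
  using step3 unfolding arc_step3_def
  by (meson mult_right_mono norm_ge_zero order_trans)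

lemma taylor_decrease:
  "sig R k / 3 * norm (step R k) ^ 3
     \<le> f (xit R k) - taylor2 f (Bmat R k) (xit R k) (step R k)"
  using model_decrease_taylor2[of f _ _ _ _ 0] step3 unfolding arc_step3_def by fastforce

lemma taylor_decrease_pos:
  assumes "0 < sig R k"
  shows "0 < f (xit R k) - taylor2 f (Bmat R k) (xit R k) (step R k)"
proof -
  have "0 < sig R k / 3 * norm (step R k) ^ 3"
    using assms step_nonzero by simp
  then show ?thesis using taylor_decrease by linarith
qed

lemma hessian_error_long:
  assumes "\<not> unsuccessful4 k" "1 \<le> norm (step R k)"
  shows "mat_norm (hess f (xit R k) - Bmat R k) \<le> p_C P"
  using accuracy ex assms unfolding arc_accuracy_def arc_successful_def arc_unsuccessful5_def
  by (meson not_le)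

lemma hessian_error_short:
  assumes "\<not> unsuccessful4 k" "norm (step R k) < 1" "0 \<le> sig R k"
  shows "mat_norm (hess f (xit R k) - Bmat R k) \<le> p_alpha P * ((\<kappa> + sig R k) * norm (step R k))"
proof -
  have "mat_norm (hess f (xit R k) - Bmat R k) \<le> p_alpha P * ((1 - p_theta P) * norm (grad f (xit R k)))"
    using accuracy ex assms unfolding arc_accuracy_def arc_successful_def arc_unsuccessful5_def
    by (simp add: mult.assoc) (meson not_le)
  also have "\<dots> \<le> p_alpha P * ((\<kappa> + sig R k) * norm (step R k))"
    using assms par by (intro mult_left_mono
        grad_le_short_step[OF symB step_nonzero _ normB model_stationarity]) auto
  finally show ?thesis .
qed

text \<open>
  With \<open>e\<close> the error of \<open>B\<^sub>k\<close>, the excess of \<open>f(x\<^sub>k + s\<^sub>k)\<close> over the quadratic model is at most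
  \<open>e/2 \<parallel>s\<^sub>k\<parallel>\<^sup>2 + L \<parallel>s\<^sub>k\<parallel>\<^sup>3\<close>. For short and for long steps alike this is at most a multiple of
  \<open>\<parallel>s\<^sub>k\<parallel>\<^sup>3\<close>, and for large \<open>\<sigma>\<^sub>k\<close> at most \<open>1 - \<eta>\<^sub>2\<close> times the model decrease.
\<close>

lemma very_successful:
  assumes n4: "\<not> unsuccessful4 k" and \<sigma>: "0 < sig R k" "sigma_large P L \<kappa> \<le> sig R k"
  shows "p_eta2 P \<le> arc_rho f R k"
proof -
  let ?s = "step R k" and ?\<sigma> = "sig R k" and ?e = "mat_norm (hess f (xit R k) - Bmat R k)"
  let ?a = "p_alpha P" and ?\<eta> = "p_eta2 P"
  define d where "d = f (xit R k) - taylor2 f (Bmat R k) (xit R k) ?s"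
  have large: "3 * (p_C P + \<kappa> + 2 * L) \<le> ?\<sigma> * (2 - 3 * ?a - 2 * ?\<eta>)"
    using \<sigma>(2) par(10) unfolding sigma_large_def by (simp add: pos_divide_le_eq)
  have "?e / 2 * (norm ?s)\<^sup>2 + L * norm ?s ^ 3 \<le> (1 - ?\<eta>) * (?\<sigma> / 3) * norm ?s ^ 3"
  proof (cases "norm ?s < 1")
    case True
    have "?e / 2 * (norm ?s)\<^sup>2 \<le> ?a * ((\<kappa> + ?\<sigma>) * norm ?s) / 2 * (norm ?s)\<^sup>2"
      using hessian_error_short[OF n4 True] \<sigma> by (intro mult_right_mono divide_right_mono) auto
    also have "\<dots> = ?a * (\<kappa> + ?\<sigma>) / 2 * norm ?s ^ 3"
      by (simp add: power2_eq_square power3_eq_cube)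
    finally have "?e / 2 * (norm ?s)\<^sup>2 + L * norm ?s ^ 3 \<le> (?a * (\<kappa> + ?\<sigma>) / 2 + L) * norm ?s ^ 3"
      by (simp add: distrib_right)
    also have "\<dots> \<le> (1 - ?\<eta>) * (?\<sigma> / 3) * norm ?s ^ 3"
    proof (rule mult_right_mono)
      have "?a * \<kappa> \<le> 1 * \<kappa>" using par \<kappa>_nonneg by (intro mult_right_mono) auto
      then show "?a * (\<kappa> + ?\<sigma>) / 2 + L \<le> (1 - ?\<eta>) * (?\<sigma> / 3)"
        using large par(15) by (simp add: field_simps)
    qed simp
    finally show ?thesis .
  next
    case False
    then have s1: "1 \<le> norm ?s" by simp
    have "?e / 2 * (norm ?s)\<^sup>2 \<le> p_C P / 2 * norm ?s ^ 3"
      using hessian_error_long[OF n4 s1] mat_norm_nonneg[of "hess f (xit R k) - Bmat R k"] s1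
      by (intro mult_mono divide_right_mono power_increasing) auto
    then have "?e / 2 * (norm ?s)\<^sup>2 + L * norm ?s ^ 3 \<le> (p_C P / 2 + L) * norm ?s ^ 3"
      by (simp add: distrib_right)
    also have "\<dots> \<le> (1 - ?\<eta>) * (?\<sigma> / 3) * norm ?s ^ 3"
    proof (rule mult_right_mono)
      have "0 \<le> ?\<sigma> * ?a" using par \<sigma> by simp
      then show "p_C P / 2 + L \<le> (1 - ?\<eta>) * (?\<sigma> / 3)"
        using large \<kappa>_nonneg by (simp add: algebra_simps)
    qed simp
    finally show ?thesis .
  qed
  also have "\<dots> \<le> (1 - ?\<eta>) * d"
    using mult_left_mono[OF taylor_decrease, of "1 - ?\<eta>"] par by (simp add: d_def)
  finally have "?\<eta> * d \<le> f (xit R k) - f (xit R k + ?s)"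
    using taylor2_upper[OF smooth _ lipschitz_step, of "Bmat R k"] L_pos
    by (simp add: d_def algebra_simps)
  moreover have "0 < d"
    using taylor_decrease_pos[OF \<sigma>(1)] by (simp add: d_def)
  ultimately show ?thesis
    by (simp add: arc_rho_def d_def pos_le_divide_eq)
qed

end

text \<open>
  Only an iteration that is not very successful increases \<open>\<sigma>\<^sub>k\<close>, by a factor of at most
  \<open>\<gamma>\<^sub>3\<close>, and then \<open>\<sigma>\<^sub>k\<close> was below the level \<open>sigma_large\<close>.
\<close>

lemma sig_bounds: "reached k \<Longrightarrow> p_sigma_min P \<le> sig R k \<and> sig R k \<le> \<sigma>_max"
proof (induction k)
  case 0
  then show ?case
    using run par unfolding arc_so_run_def sigma_max_def by auto
next
  case (Suc k)
  then have ex: "executed k" using reached_Suc by simp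
  then have IH: "p_sigma_min P \<le> sig R k" "sig R k \<le> \<sigma>_max"
    using Suc.IH executed_reached by auto
  then have pos: "0 < sig R k" using par by linarith
  have grow: "p_gamma3 P * sig R k \<le> \<sigma>_max"
    if "\<not> unsuccessful4 k" "arc_rho f R k < p_eta2 P"
  proof -
    have "sig R k \<le> sigma_large P L \<kappa>"
      using very_successful[OF ex that(1) pos] that(2) by linarith
    then have "p_gamma3 P * sig R k \<le> p_gamma3 P * sigma_large P L \<kappa>"
      using par by (intro mult_left_mono) auto
    then show ?thesis by (simp add: sigma_max_def)
  qed
  have 23: "p_gamma2 P * sig R k \<le> p_gamma3 P * sig R k" "sig R k \<le> p_gamma2 P * sig R k"
    using par pos by auto
  show ?case
  proof (cases k rule: iteration_cases)
    case 1
    then have "\<not> unsuccessful4 k" by (simp add: arc_successful_def)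
    then show ?thesis
      using update_successful[OF ex 1(1)] IH grow 23 unfolding arc_update_successful_def
      by (cases "p_eta2 P \<le> arc_rho f R k") auto
  next
    case 2
    then show ?thesis using update4[OF ex 2(1)] IH unfolding arc_update4_def by simp
  next
    case 3
    then have "\<not> unsuccessful4 k" "arc_rho f R k < p_eta2 P"
      using par by (auto simp: arc_unsuccessful5_def)
    then show ?thesis
      using update5[OF ex 3(1)] IH grow 23 unfolding arc_update_unsuccessful5_def by auto
  qed
qed

section \<open>Guaranteed decrease at successful iterations\<close>

lemma sigma_max_pos: "0 < \<sigma>_max"
  using par unfolding sigma_max_def by simp

lemma grad_const_ge_1: "1 \<le> \<zeta>"
proof -
  have "0 \<le> (p_alpha P + p_theta P / (1 - p_theta P)) * (\<kappa> + \<sigma>_max)"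
    using par \<kappa>_nonneg sigma_max_pos by (intro mult_nonneg_nonneg add_nonneg_nonneg) auto
  then show ?thesis
    unfolding grad_const_def using L_pos sigma_max_pos by linarith
qed

lemma decrease_const_pos: "0 < c"
  unfolding decrease_const_def using par sigma_max_pos grad_const_ge_1 by auto

lemma successful_decrease:
  assumes ex: "executed k" and "successful k"
  shows "p_eta1 P * (f (xit R k) - taylor2 f (Bmat R k) (xit R k) (step R k))
           \<le> f (xit R k) - f (xit R (Suc k))"
proof -
  have "0 < sig R k"
    using sig_bounds[OF executed_reached[OF ex]] par by linarith
  then have "0 < f (xit R k) - taylor2 f (Bmat R k) (xit R k) (step R k)"
    by (rule taylor_decrease_pos[OF ex])
  then show ?thesis
    using assms update_successful[OF assms]
    unfolding arc_successful_def arc_rho_def arc_update_successful_def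
    by (simp add: pos_le_divide_eq)
qed

text \<open>
  The new gradient splits into the Taylor remainder of \<open>\<nabla>f\<close>, the Hessian error applied to the step, the
  model gradient and the cubic term. Each is at most quadratic in the step; for the Hessian error, and for a model
  gradient measured against \<open>\<parallel>s\<^sub>k\<parallel> \<parallel>\<nabla>f(x\<^sub>k)\<parallel>\<close>, because the step controls the gradient.
\<close>

lemma next_grad_short:
  assumes ex: "executed k" and succ: "successful k" and short: "norm (step R k) < 1"
  shows "norm (grad f (xit R (Suc k))) \<le> \<zeta> * (norm (step R k))\<^sup>2"
proof -
  let ?s = "step R k" and ?x = "xit R k" and ?B = "Bmat R k"
  let ?H = "hess f (xit R k)" and ?m = "cubic_model_grad f (Bmat R k) (xit R k) (step R k) (sig R k)"
  let ?\<theta> = "p_theta P" and ?\<sigma> = "sig R k"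
  have n4: "\<not> unsuccessful4 k" using succ by (simp add: arc_successful_def)
  have \<sigma>: "0 \<le> ?\<sigma>" "?\<sigma> \<le> \<sigma>_max"
    using sig_bounds[OF executed_reached[OF ex]] par by linarith+
  have cubic: "a * norm ?s * norm ?s \<le> b * (norm ?s)\<^sup>2" if "a \<le> b" for a b
    using that by (simp add: power2_eq_square mult.assoc mult_right_mono)
  have 1: "norm (grad f (?x + ?s) - grad f ?x - ?H *v ?s) \<le> L * (norm ?s)\<^sup>2"
    using grad_taylor[OF smooth _ lipschitz_step[OF ex], of 1] L_pos by simp
  have 2: "norm ((?H - ?B) *v ?s) \<le> p_alpha P * (\<kappa> + \<sigma>_max) * (norm ?s)\<^sup>2"
  proof -
    have "norm ((?H - ?B) *v ?s) \<le> mat_norm (?H - ?B) * norm ?s"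
      by (rule norm_mult_le_mat_norm)
    also have "\<dots> \<le> p_alpha P * (\<kappa> + ?\<sigma>) * norm ?s * norm ?s"
      using mult_right_mono[OF hessian_error_short[OF ex n4 short \<sigma>(1)], of "norm ?s"]
      by (simp add: mult.assoc)
    also have "\<dots> \<le> p_alpha P * (\<kappa> + \<sigma>_max) * (norm ?s)\<^sup>2"
      using \<sigma> par by (intro cubic mult_left_mono) auto
    finally show ?thesis .
  qed
  have 3: "norm ?m \<le> (1 + ?\<theta> / (1 - ?\<theta>) * (\<kappa> + \<sigma>_max)) * (norm ?s)\<^sup>2"
    using step_condition
  proof
    assume "step_condition_a f P \<epsilon> \<epsilon>H R"
    then have "norm ?m \<le> ?\<theta> * min ((norm ?s)\<^sup>2) (norm (grad f ?x))"
      using ex unfolding step_condition_a_def by blast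
    also have "\<dots> \<le> 1 * (norm ?s)\<^sup>2"
      using par by (intro mult_mono) auto
    also have "\<dots> \<le> (1 + ?\<theta> / (1 - ?\<theta>) * (\<kappa> + \<sigma>_max)) * (norm ?s)\<^sup>2"
      using par \<kappa>_nonneg sigma_max_pos by (intro mult_right_mono) auto
    finally show ?thesis .
  next
    assume "step_condition_b f P \<epsilon> \<epsilon>H R"
    then have "norm ?m \<le> ?\<theta> * min 1 (norm ?s) * norm (grad f ?x)"
      using ex unfolding step_condition_b_def by blast
    also have "\<dots> = ?\<theta> / (1 - ?\<theta>) * norm ?s * ((1 - ?\<theta>) * norm (grad f ?x))"
      using short par by simp
    also have "\<dots> \<le> ?\<theta> / (1 - ?\<theta>) * norm ?s * ((\<kappa> + ?\<sigma>) * norm ?s)"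
      using par short \<sigma>
      by (intro mult_left_mono grad_le_short_step[OF symB[OF ex] step_nonzero[OF ex] _
            normB[OF ex] model_stationarity[OF ex]]) auto
    also have "\<dots> = ?\<theta> / (1 - ?\<theta>) * (\<kappa> + ?\<sigma>) * norm ?s * norm ?s"
      by (simp add: mult.commute mult.left_commute)
    also have "\<dots> \<le> (1 + ?\<theta> / (1 - ?\<theta>) * (\<kappa> + \<sigma>_max)) * (norm ?s)\<^sup>2"
    proof (rule cubic)
      have "?\<theta> / (1 - ?\<theta>) * (\<kappa> + ?\<sigma>) \<le> ?\<theta> / (1 - ?\<theta>) * (\<kappa> + \<sigma>_max)"
        using par \<sigma> by (intro mult_left_mono) auto
      then show "?\<theta> / (1 - ?\<theta>) * (\<kappa> + ?\<sigma>) \<le> 1 + ?\<theta> / (1 - ?\<theta>) * (\<kappa> + \<sigma>_max)"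
        by linarith
    qed
    finally show ?thesis .
  qed
  have 4: "norm ((?\<sigma> * norm ?s) *\<^sub>R ?s) \<le> \<sigma>_max * (norm ?s)\<^sup>2"
    using \<sigma> cubic[OF \<sigma>(2)] by simp
  have "grad f (?x + ?s) = (grad f (?x + ?s) - grad f ?x - ?H *v ?s) + (?H - ?B) *v ?s
      + ?m - (?\<sigma> * norm ?s) *\<^sub>R ?s"
    by (simp add: cubic_model_grad_eq[OF symB[OF ex] step_nonzero[OF ex]]
        matrix_vector_mult_diff_rdistrib)
  from arg_cong[OF this, of norm]
  have "norm (grad f (?x + ?s)) \<le> norm (grad f (?x + ?s) - grad f ?x - ?H *v ?s)
      + norm ((?H - ?B) *v ?s) + norm ?m + norm ((?\<sigma> * norm ?s) *\<^sub>R ?s)"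
    using norm_triangle_ineq4[of "grad f (?x + ?s) - grad f ?x - ?H *v ?s + (?H - ?B) *v ?s + ?m"
        "(?\<sigma> * norm ?s) *\<^sub>R ?s"]
      norm_triangle_ineq[of "grad f (?x + ?s) - grad f ?x - ?H *v ?s + (?H - ?B) *v ?s" ?m]
      norm_triangle_ineq[of "grad f (?x + ?s) - grad f ?x - ?H *v ?s" "(?H - ?B) *v ?s"]
    by linarith
  also have "\<dots> \<le> \<zeta> * (norm ?s)\<^sup>2"
    using 1 2 3 4 by (simp add: grad_const_def algebra_simps)
  finally show ?thesis
    using update_successful[OF ex succ] by (simp add: arc_update_successful_def)
qed

text \<open>
  A gradient that stays large forces \<open>\<epsilon> \<le> \<zeta> \<parallel>s\<^sub>k\<parallel>\<^sup>2\<close>, and the model decrease is cubic in the length of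
  the step. Long steps satisfy the same bound because \<open>\<epsilon> \<le> 1 \<le> \<zeta>\<close>.
\<close>

lemma decrease_if_next_grad_large:
  assumes ex: "executed k" and succ: "successful k" and large: "\<epsilon> < norm (grad f (xit R (Suc k)))"
  shows "c * \<epsilon> powr (3/2) \<le> f (xit R k) - f (xit R (Suc k))"
proof -
  let ?s = "norm (step R k)"
  have \<zeta>: "0 < \<zeta>" using grad_const_ge_1 by linarith
  have "\<epsilon> \<le> \<zeta> * ?s\<^sup>2"
  proof (cases "?s < 1")
    case True
    then show ?thesis using next_grad_short[OF ex succ] large by linarith
  next
    case False
    then have "1 \<le> ?s\<^sup>2" by simp
    then have "1 * 1 \<le> \<zeta> * ?s\<^sup>2" using grad_const_ge_1 by (intro mult_mono) auto
    then show ?thesis using tol by linarith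
  qed
  then have "\<epsilon> powr (3/2) \<le> (\<zeta> * ?s\<^sup>2) powr (3/2)"
    using tol by (intro powr_mono2) auto
  also have "\<dots> = \<zeta> powr (3/2) * ?s ^ 3"
  proof -
    have "(?s\<^sup>2) powr (3/2) = (?s powr 2) powr (3/2)"
      using step_nonzero[OF ex] by simp
    also have "\<dots> = ?s powr 3"
      unfolding powr_powr by simp
    also have "\<dots> = ?s ^ 3"
      using step_nonzero[OF ex] by simp
    finally show ?thesis
      using \<zeta> by (simp add: powr_mult)
  qed
  finally have "\<zeta> powr (-3/2) * \<epsilon> powr (3/2) \<le> \<zeta> powr (-3/2) * (\<zeta> powr (3/2) * ?s ^ 3)"
    by (intro mult_left_mono) auto
  also have "\<dots> = ?s ^ 3"
    using \<zeta> by (simp flip: mult.assoc powr_add)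
  finally have s: "\<zeta> powr (-3/2) * \<epsilon> powr (3/2) \<le> ?s ^ 3" .
  have "c * \<epsilon> powr (3/2) \<le> p_eta1 P * (p_sigma_min P / 3 * \<zeta> powr (-3/2)) * \<epsilon> powr (3/2)"
    unfolding decrease_const_def using par by (intro mult_right_mono mult_left_mono) auto
  also have "\<dots> = p_eta1 P * (p_sigma_min P / 3 * (\<zeta> powr (-3/2) * \<epsilon> powr (3/2)))"
    by simp
  also have "\<dots> \<le> p_eta1 P * (sig R k / 3 * ?s ^ 3)"
    using s par sig_bounds[OF executed_reached[OF ex]] by (intro mult_left_mono mult_mono) auto
  also have "\<dots> \<le> p_eta1 P * (f (xit R k) - taylor2 f (Bmat R k) (xit R k) (step R k))"
    using par taylor_decrease[OF ex] by (intro mult_left_mono) auto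
  also have "\<dots> \<le> f (xit R k) - f (xit R (Suc k))"
    by (rule successful_decrease[OF ex succ])
  finally show ?thesis .
qed

lemma decrease_if_negative_curvature:
  assumes ex: "executed k" and succ: "successful k" and neg: "lambda_min (Bmat R k) < - \<epsilon>H"
  shows "c * \<epsilon>H ^ 3 \<le> f (xit R k) - f (xit R (Suc k))"
proof -
  let ?\<tau> = "p_kappa_snc P * \<epsilon>H" and ?u = "uvec R k"
  let ?m = "\<lambda>s. cubic_model f (Bmat R k) (xit R k) s (sig R k)"
  have \<sigma>: "0 < sig R k" "sig R k \<le> \<sigma>_max"
    using sig_bounds[OF executed_reached[OF ex]] par by linarith+
  have "\<not> positive_semidefinite (Bmat R k)"
    using lambda_min_neg_not_psd[OF symB[OF ex]] neg tol by linarith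
  then have eig: "arc_eigenstep_ok f P R k" "?m (step R k) \<le> ?m (eigenstep R k)"
    using step3[OF ex] unfolding arc_step3_def by blast+
  have "?u \<bullet> (Bmat R k *v ?u) \<le> p_kappa_snc P * lambda_min (Bmat R k) * (norm ?u)\<^sup>2"
    using eig(1) unfolding arc_eigenstep_ok_def by blast
  also have "\<dots> \<le> p_kappa_snc P * (- \<epsilon>H) * (norm ?u)\<^sup>2"
    using neg par by (intro mult_right_mono mult_left_mono) auto
  finally have "?u \<bullet> (Bmat R k *v ?u) \<le> - ?\<tau> * (norm ?u)\<^sup>2" by simp
  then have "?m (eigenstep R k) \<le> f (xit R k) - ?\<tau> ^ 3 / (6 * (sig R k)\<^sup>2)"
    using eig(1) \<sigma> par tol unfolding eigenstep_def arc_eigenstep_ok_def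
    by (intro eigenstep_decrease) auto
  with eig(2) have "?m (step R k) \<le> f (xit R k) - ?\<tau> ^ 3 / (6 * (sig R k)\<^sup>2)"
    by linarith
  from model_decrease_taylor2[OF this]
  have dec: "?\<tau> ^ 3 / (6 * (sig R k)\<^sup>2)
      \<le> f (xit R k) - taylor2 f (Bmat R k) (xit R k) (step R k)"
    using \<sigma>(1) by (smt (verit) divide_nonneg_pos mult_nonneg_nonneg norm_ge_zero zero_le_power)
  have "c * \<epsilon>H ^ 3 \<le> p_eta1 P * (p_kappa_snc P ^ 3 / (6 * \<sigma>_max\<^sup>2)) * \<epsilon>H ^ 3"
    unfolding decrease_const_def using par tol by (intro mult_right_mono mult_left_mono) auto
  also have "\<dots> = p_eta1 P * (?\<tau> ^ 3 / (6 * \<sigma>_max\<^sup>2))"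
    by (simp add: power_mult_distrib)
  also have "\<dots> \<le> p_eta1 P * (?\<tau> ^ 3 / (6 * (sig R k)\<^sup>2))"
    using \<sigma> par tol by (intro mult_left_mono divide_left_mono power_mono mult_pos_pos) auto
  also have "\<dots> \<le> p_eta1 P * (f (xit R k) - taylor2 f (Bmat R k) (xit R k) (step R k))"
    using dec par by (intro mult_left_mono) auto
  also have "\<dots> \<le> f (xit R k) - f (xit R (Suc k))"
    by (rule successful_decrease[OF ex succ])
  finally show ?thesis .
qed

section \<open>Counting iterations\<close>

definition M where "M = max (\<epsilon> powr (-3/2)) (\<epsilon>H powr (-3))"

lemma M_ge_1: "1 \<le> M"
  using tol powr_mono2'[of "-3/2" \<epsilon> 1] by (simp add: M_def)

lemma inverse_M_le: "1 / M \<le> \<epsilon> powr (3/2)" "1 / M \<le> \<epsilon>H ^ 3"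
proof -
  have "1 / M \<le> 1 / \<epsilon> powr (-3/2)" "1 / M \<le> 1 / \<epsilon>H powr (-3)"
    using tol by (auto intro!: divide_left_mono mult_pos_pos simp: M_def less_max_iff_disj)
  then show "1 / M \<le> \<epsilon> powr (3/2)" "1 / M \<le> \<epsilon>H ^ 3"
    using tol by (simp_all add: powr_minus_divide)
qed

definition n_succ :: "nat \<Rightarrow> real" where "n_succ k = (\<Sum>j<k. of_bool (successful j))"
definition n_unsucc4 :: "nat \<Rightarrow> real" where "n_unsucc4 k = (\<Sum>j<k. of_bool (unsuccessful4 j))"
definition n_unsucc5 :: "nat \<Rightarrow> real" where "n_unsucc5 k = (\<Sum>j<k. of_bool (unsuccessful5 j))"

lemma counts_0 [simp]: "n_succ 0 = 0" "n_unsucc4 0 = 0" "n_unsucc5 0 = 0"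
  and counts_Suc [simp]:
    "n_succ (Suc k) = n_succ k + of_bool (successful k)"
    "n_unsucc4 (Suc k) = n_unsucc4 k + of_bool (unsuccessful4 k)"
    "n_unsucc5 (Suc k) = n_unsucc5 k + of_bool (unsuccessful5 k)"
  unfolding n_succ_def n_unsucc4_def n_unsucc5_def by simp_all

lemma iteration_split: "real k = n_succ k + n_unsucc4 k + n_unsucc5 k"
proof (induction k)
  case (Suc k)
  then show ?case by (cases k rule: iteration_cases) auto
qed simp

text \<open>
  A unit \<open>c/M\<close> is lent on arrival at a point with gradient at most \<open>\<epsilon>\<close>, where no decrease is guaranteed.
  The next successful iteration repays it: the algorithm has not stopped there, so that iteration gains from
  negative curvature. Each guaranteed decrease thus pays for up to two iterations, whence the factor \<open>2\<close>.
\<close>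

lemma n_succ_potential:
  "reached k \<Longrightarrow> n_succ k * (c / M)
     \<le> 2 * (f x0 - f (xit R k)) + c / M * of_bool (norm (grad f (xit R k)) \<le> \<epsilon>)"
proof (induction k)
  case 0
  show ?case
    using run decrease_const_pos M_ge_1 by (simp add: arc_so_run_def)
next
  case (Suc k)
  then have ex: "executed k" using reached_Suc by simp
  note IH = Suc.IH[OF executed_reached[OF ex]]
  have cM: "0 < c / M" using decrease_const_pos M_ge_1 by simp
  show ?case
  proof (cases "successful k")
    case True
    have nonincr: "f (xit R (Suc k)) \<le> f (xit R k)"
    proof -
      have "0 < sig R k"
        using sig_bounds[OF executed_reached[OF ex]] par by linarith
      then have "0 \<le> p_eta1 P * (f (xit R k) - taylor2 f (Bmat R k) (xit R k) (step R k))"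
        using taylor_decrease_pos[OF ex] par by (intro mult_nonneg_nonneg) auto
      then show ?thesis using successful_decrease[OF ex True] by linarith
    qed
    have n: "n_succ (Suc k) * (c / M) = n_succ k * (c / M) + c / M"
      using True by (simp add: distrib_right add_divide_distrib)
    have "c * (1 / M) \<le> c * \<epsilon> powr (3/2)" "c * (1 / M) \<le> c * \<epsilon>H ^ 3"
      by (rule mult_left_mono[OF inverse_M_le(1)] mult_left_mono[OF inverse_M_le(2)],
          use decrease_const_pos in simp)+
    then have c_le: "c / M \<le> c * \<epsilon> powr (3/2)" "c / M \<le> c * \<epsilon>H ^ 3"
      by simp_all
    have dec_g: "c / M \<le> f (xit R k) - f (xit R (Suc k))"
      if "\<epsilon> < norm (grad f (xit R (Suc k)))"
      using decrease_if_next_grad_large[OF ex True that] c_le by linarith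
    have dec_H: "c / M \<le> f (xit R k) - f (xit R (Suc k))"
      if "lambda_min (Bmat R k) < - \<epsilon>H"
      using decrease_if_negative_curvature[OF ex True that] c_le by linarith
    show ?thesis
    proof (cases "norm (grad f (xit R k)) \<le> \<epsilon>")
      case small: True
      then have "lambda_min (Bmat R k) < - \<epsilon>H"
        using ex unfolding arc_executed_def arc_stops_def by force
      then have "c / M \<le> f (xit R k) - f (xit R (Suc k))" by (rule dec_H)
      then show ?thesis using IH cM small unfolding n by (auto simp: algebra_simps)
    next
      case False
      then show ?thesis
        using IH dec_g nonincr cM unfolding n
        by (cases "norm (grad f (xit R (Suc k))) \<le> \<epsilon>") auto
    qed
  next
    case False
    then have "xit R (Suc k) = xit R k"
      using update4[OF ex] update5[OF ex]
      by (cases k rule: iteration_cases) (auto simp: arc_update4_def arc_update_unsuccessful5_def)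
    then show ?thesis using IH False by simp
  qed
qed

text \<open>
  A Step 4 iteration consumes the flag, and only a successful iteration restores it; the summand \<open>1\<close> is the
  initial flag.
\<close>

lemma n_unsucc4_bound: "reached k \<Longrightarrow> n_unsucc4 k + of_bool (flg R k) \<le> 1 + n_succ k"
proof (induction k)
  case 0
  then show ?case by simp
next
  case (Suc k)
  then have ex: "executed k" using reached_Suc by simp
  note IH = Suc.IH[OF executed_reached[OF ex]]
  show ?case
  proof (cases k rule: iteration_cases)
    case 1
    then show ?thesis using IH by (cases "flg R k"; cases "flg R (Suc k)") auto
  next
    case 2
    then show ?thesis using IH update4[OF ex 2(1)]
      by (auto simp: arc_unsuccessful4_def arc_update4_def)
  next
    case 3
    then show ?thesis using IH update5[OF ex 3(1)]
      by (auto simp: arc_update_unsuccessful5_def)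
  qed
qed

lemma n_unsucc5_potential:
  "reached k \<Longrightarrow> ln (p_sigma0 P) + n_unsucc5 k * ln (p_gamma2 P) + n_succ k * ln (p_gamma1 P)
     \<le> ln (sig R k)"
proof (induction k)
  case 0
  then show ?case using run by (simp add: arc_so_run_def)
next
  case (Suc k)
  then have ex: "executed k" using reached_Suc by simp
  note IH = Suc.IH[OF executed_reached[OF ex]]
  have pos: "0 < sig R k"
    using sig_bounds[OF executed_reached[OF ex]] par by linarith
  show ?case
  proof (cases k rule: iteration_cases)
    case 1
    have "p_gamma1 P * sig R k \<le> 1 * sig R k"
      using par pos by (intro mult_right_mono) auto
    then have "p_gamma1 P * sig R k \<le> sig R (Suc k)"
      using update_successful[OF ex 1(1)] unfolding arc_update_successful_def
      by (auto split: if_splits)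
    then have "ln (p_gamma1 P * sig R k) \<le> ln (sig R (Suc k))"
      using par pos by (intro ln_mono) auto
    then show ?thesis using 1 IH par pos
      by (simp add: ln_mult algebra_simps)
  next
    case 2
    then show ?thesis using IH update4[OF ex 2(1)]
      by (simp add: arc_update4_def)
  next
    case 3
    then have "ln (p_gamma2 P * sig R k) \<le> ln (sig R (Suc k))"
      using par pos update5[OF ex 3(1)] unfolding arc_update_unsuccessful5_def
      by (intro ln_mono) auto
    then show ?thesis using 3 IH par pos
      by (simp add: ln_mult algebra_simps)
  qed
qed

end

text \<open>
  The first factor counts one successful iteration together with the unsuccessful ones of both kinds charged to
  it; the last two summands pay for the initial flag and for the range of \<open>ln \<sigma>\<^sub>k\<close> between
  \<open>ln \<sigma>\<^sub>0\<close> and \<open>ln \<sigma>_max\<close>.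
\<close>

definition complexity_const :: "arc_params \<Rightarrow> real \<Rightarrow> real \<Rightarrow> real \<Rightarrow> real" where
  "complexity_const P L \<kappa> \<Delta> =
     (2 - ln (p_gamma1 P) / ln (p_gamma2 P)) * (2 * \<Delta> / decrease_const P L \<kappa> + 1)
     + 1 + ln (sigma_max P L \<kappa> / p_sigma0 P) / ln (p_gamma2 P)"

context arc_so_execution
begin

lemma log_par:
  "0 < ln (p_gamma2 P)" "0 \<le> - ln (p_gamma1 P) / ln (p_gamma2 P)"
  "0 \<le> ln (\<sigma>_max / p_sigma0 P) / ln (p_gamma2 P)"
proof -
  show g2: "0 < ln (p_gamma2 P)" using par by simp
  then show "0 \<le> - ln (p_gamma1 P) / ln (p_gamma2 P)"
    using par by (intro divide_nonneg_pos) auto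
  have "1 \<le> \<sigma>_max / p_sigma0 P" using par by (simp add: sigma_max_def)
  then show "0 \<le> ln (\<sigma>_max / p_sigma0 P) / ln (p_gamma2 P)"
    using g2 by (intro divide_nonneg_pos ln_ge_zero)
qed

lemma iteration_bound:
  assumes low: "\<And>y. f_low \<le> f y" and k: "reached k"
  shows "real k \<le> complexity_const P L \<kappa> (f x0 - f_low) * M"
proof -
  let ?A = "2 - ln (p_gamma1 P) / ln (p_gamma2 P)"
  let ?D = "ln (\<sigma>_max / p_sigma0 P) / ln (p_gamma2 P)"
  let ?\<Delta> = "f x0 - f_low"
  have cM: "0 < c / M" using decrease_const_pos M_ge_1 by simp
  have A: "0 \<le> ?A" using log_par(2) by simp
  have "n_succ k * (c / M) \<le> 2 * ?\<Delta> + c / M"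
  proof -
    define r where "r = c / M"
    have "r * of_bool (norm (grad f (xit R k)) \<le> \<epsilon>) \<le> r"
      using cM by (simp add: r_def mult_left_le)
    then show ?thesis
      using n_succ_potential[OF k] low[of "xit R k"] by (fold r_def) argo
  qed
  then have S: "n_succ k \<le> 2 * ?\<Delta> / c * M + 1"
    using decrease_const_pos M_ge_1 by (simp add: field_simps)
  have "ln (sig R k) \<le> ln \<sigma>_max"
    using sig_bounds[OF k] par by (intro ln_mono) linarith+
  then have "n_unsucc5 k * ln (p_gamma2 P)
      \<le> ln (\<sigma>_max / p_sigma0 P) - n_succ k * ln (p_gamma1 P)"
    using n_unsucc5_potential[OF k] sigma_max_pos par by (simp add: ln_div)
  then have U5: "n_unsucc5 k \<le> ?D - n_succ k * (ln (p_gamma1 P) / ln (p_gamma2 P))"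
    using log_par(1) by (simp add: field_simps)
  have U4: "n_unsucc4 k \<le> 1 + n_succ k"
    using n_unsucc4_bound[OF k] by (smt (verit) of_bool_less_eq_one zero_less_eq_of_bool)
  have "real k \<le> ?A * n_succ k + 1 + ?D"
    using iteration_split[of k] U4 U5 by (simp add: algebra_simps)
  also have "\<dots> \<le> ?A * (2 * ?\<Delta> / c * M + 1) + 1 + ?D"
    using S A by (intro add_right_mono mult_left_mono) auto
  also have "\<dots> \<le> ?A * (2 * ?\<Delta> / c * M + 1 * M) + 1 * M + ?D * M"
  proof -
    have "?A * 1 \<le> ?A * M" "?D * 1 \<le> ?D * M"
      using A log_par(3) M_ge_1 by (simp_all only: mult_left_mono)
    then show ?thesis using M_ge_1 by (simp only: distrib_left mult_1 mult_1_right)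
  qed
  also have "\<dots> = complexity_const P L \<kappa> ?\<Delta> * M"
    by (simp add: complexity_const_def algebra_simps)
  finally show ?thesis .
qed

lemma stops_in_time:
  assumes low: "\<And>y. f_low \<le> f y"
  obtains k where "reached k" "arc_stops f \<epsilon> \<epsilon>H R k"
    "real k \<le> complexity_const P L \<kappa> (f x0 - f_low) * M"
proof -
  have "\<exists>k. arc_stops f \<epsilon> \<epsilon>H R k"
  proof (rule ccontr)
    assume "\<not> ?thesis"
    then have "reached k" for k by (simp add: arc_reached_def)
    then have "real k \<le> complexity_const P L \<kappa> (f x0 - f_low) * M" for k
      using iteration_bound[OF low] by blast
    then show False
      using reals_Archimedean2 linorder_not_le by blast
  qed
  then obtain k where k: "arc_stops f \<epsilon> \<epsilon>H R k" "\<forall>j<k. \<not> arc_stops f \<epsilon> \<epsilon>H R j"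
    using exists_least_iff[of "arc_stops f \<epsilon> \<epsilon>H R"] by blast
  then have "reached k" by (simp add: arc_reached_def)
  with k(1) iteration_bound[OF low this] show thesis by (rule that[rotated])
qed

end

section \<open>Worst-case complexity\<close>

theorem mainTheorem8:
  fixes f :: "real^'n \<Rightarrow> real" and x0 :: "real^'n" and P :: arc_params
    and f_low L \<kappa>B \<kappa>H :: real
  assumes "twice_cont_diff f"
    and "\<And>x. f_low \<le> f x"
    and "arc_params_ok P"
    and "0 < L" and "0 \<le> \<kappa>B"
  shows "\<exists>K>0. \<exists>\<delta>>0. \<forall>\<epsilon> \<epsilon>H. \<forall>R :: 'n arc_run.
           0 < \<epsilon> \<and> \<epsilon> \<le> \<delta> \<and> 0 < \<epsilon>H \<and> \<epsilon>H \<le> \<delta> \<and>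
           arc_so_run f x0 P \<epsilon> \<epsilon>H R \<and>
           arc_accuracy f P \<epsilon> \<epsilon>H R \<and>
           hess_lipschitz_on_steps f L \<epsilon> \<epsilon>H R \<and>
           B_bounded f \<kappa>B \<epsilon> \<epsilon>H R \<and>
           (step_condition_a f P \<epsilon> \<epsilon>H R \<or>
            step_condition_b f P \<epsilon> \<epsilon>H R \<and> hess_bounded_on_steps f \<kappa>H \<epsilon> \<epsilon>H R) \<longrightarrow>
           (\<exists>k. arc_reached f \<epsilon> \<epsilon>H R k \<and>
                norm (grad f (xit R k)) \<le> \<epsilon> \<and> lambda_min (Bmat R k) \<ge> - \<epsilon>H \<and>
                real k \<le> K * max (\<epsilon> powr (-3/2)) (\<epsilon>H powr (-3)))"
proof -
  let ?K = "max 1 (complexity_const P L \<kappa>B (f x0 - f_low))"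
  have "\<exists>k. arc_reached f \<epsilon> \<epsilon>H R k \<and>
          norm (grad f (xit R k)) \<le> \<epsilon> \<and> lambda_min (Bmat R k) \<ge> - \<epsilon>H \<and>
          real k \<le> ?K * max (\<epsilon> powr (-3/2)) (\<epsilon>H powr (-3))"
    if "0 < \<epsilon>" "\<epsilon> \<le> 1" "0 < \<epsilon>H" "\<epsilon>H \<le> 1" "arc_so_run f x0 P \<epsilon> \<epsilon>H R"
      "arc_accuracy f P \<epsilon> \<epsilon>H R" "hess_lipschitz_on_steps f L \<epsilon> \<epsilon>H R"
      "B_bounded f \<kappa>B \<epsilon> \<epsilon>H R" "step_condition_a f P \<epsilon> \<epsilon>H R \<or> step_condition_b f P \<epsilon> \<epsilon>H R"
    for \<epsilon> \<epsilon>H and R :: "'n arc_run"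
  proof -
    interpret arc_so_execution f x0 P L \<kappa>B \<epsilon> \<epsilon>H R
      using assms that by unfold_locales auto
    obtain k where k: "reached k" "arc_stops f \<epsilon> \<epsilon>H R k"
      "real k \<le> complexity_const P L \<kappa>B (f x0 - f_low) * M"
      using stops_in_time[OF assms(2)] .
    have "complexity_const P L \<kappa>B (f x0 - f_low) * M \<le> ?K * M"
      using M_ge_1 by (intro mult_right_mono) auto
    with k show ?thesis
      unfolding arc_stops_def M_def by (meson order_trans)
  qed
  then have "\<forall>\<epsilon> \<epsilon>H. \<forall>R :: 'n arc_run.
           0 < \<epsilon> \<and> \<epsilon> \<le> 1 \<and> 0 < \<epsilon>H \<and> \<epsilon>H \<le> 1 \<and>
           arc_so_run f x0 P \<epsilon> \<epsilon>H R \<and>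
           arc_accuracy f P \<epsilon> \<epsilon>H R \<and>
           hess_lipschitz_on_steps f L \<epsilon> \<epsilon>H R \<and>
           B_bounded f \<kappa>B \<epsilon> \<epsilon>H R \<and>
           (step_condition_a f P \<epsilon> \<epsilon>H R \<or>
            step_condition_b f P \<epsilon> \<epsilon>H R \<and> hess_bounded_on_steps f \<kappa>H \<epsilon> \<epsilon>H R) \<longrightarrow>
           (\<exists>k. arc_reached f \<epsilon> \<epsilon>H R k \<and>
                norm (grad f (xit R k)) \<le> \<epsilon> \<and> lambda_min (Bmat R k) \<ge> - \<epsilon>H \<and>
                real k \<le> ?K * max (\<epsilon> powr (-3/2)) (\<epsilon>H powr (-3)))"
    by blast
  moreover have "0 < ?K" "(0::real) < 1" by simp_all
  ultimately show ?thesis by blast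
qed

end
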